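(* Let $\Bbbk$ be a field. Let $f\colon \mathbb{N}\rightarrow\mathbb{N}$ be an increasing, polynomially bounded function. Then there exists a finitely generated Lie algebra $L$ over $\Bbbk$ such that $\gamma_L(n)\sim f(n)$.
   Context: Growth functions: if $A$ is a (not necessarily associative) $\Bbbk$-algebra generated by a finite set $X$, let $X^{\leq n}$ be the set of all products (with all arrangements of parentheses) of at most $n$ elements of $X$, and put $\gamma_{A,X}(n)=\dim_\Bbbk \operatorname{Span}_\Bbbk X^{\leq n}$ for $n\geq 1$. For a Lie algebra the product is the Lie bracket. Asymptotic equivalence: for non-decreasing functions $f,g$ on the positive integers with values in the non-negative integers, $f\preceq g$ means that there are positive constants $C,D$ (with $D$ an integer) such that $f(n)\leq C g(Dn)$ for all $n\geq 1$; $f\sim g$ (bi-Lipschitz equivalence) means $f\preceq g$ and $g\preceq f$. The $\sim$-class of $\gamma_{A,X}$ does not depend on the finite generating set $X$; one writes $\gamma_A$ for $\gamma_{A,X}$ with any choice of $X$. "Increasing" means strictly increasing (as opposed to "non-decreasing"). "Polynomially bounded" means that $f(n)\leq Kn^d$ for all $n\ge 1$, for some constants $K,d>0$. Functions are considered with arguments $n\geq 1$. *)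

theory Defs
  imports Complex_Main "HOL-Library.Function_Algebras"
begin

text \<open>
  The carrier \<open>L\<close> is a subspace of an ambient vector space, so that Lie algebras can be
  quantified over. Only the values of the bracket on \<open>L\<close> matter. The bracket is alternating
  (not merely antisymmetric), the right notion also in characteristic 2.
\<close>

locale lie_algebra = vector_space scale
  for scale :: "'k::field \<Rightarrow> 'a::ab_group_add \<Rightarrow> 'a" +
  fixes L :: "'a set"
    and bracket :: "'a \<Rightarrow> 'a \<Rightarrow> 'a"
  assumes subspace_carrier: "subspace L"
    and bracket_closed: "\<lbrakk>x \<in> L; y \<in> L\<rbrakk> \<Longrightarrow> bracket x y \<in> L"
    and bracket_add_left:
      "\<lbrakk>x \<in> L; y \<in> L; z \<in> L\<rbrakk> \<Longrightarrow> bracket (x + y) z = bracket x z + bracket y z"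
    and bracket_add_right:
      "\<lbrakk>x \<in> L; y \<in> L; z \<in> L\<rbrakk> \<Longrightarrow> bracket x (y + z) = bracket x y + bracket x z"
    and bracket_scale_left:
      "\<lbrakk>x \<in> L; y \<in> L\<rbrakk> \<Longrightarrow> bracket (scale c x) y = scale c (bracket x y)"
    and bracket_scale_right:
      "\<lbrakk>x \<in> L; y \<in> L\<rbrakk> \<Longrightarrow> bracket x (scale c y) = scale c (bracket x y)"
    and bracket_alternating: "x \<in> L \<Longrightarrow> bracket x x = 0"
    and bracket_jacobi:
      "\<lbrakk>x \<in> L; y \<in> L; z \<in> L\<rbrakk> \<Longrightarrow>
        bracket x (bracket y z) + bracket y (bracket z x) + bracket z (bracket x y) = 0"
begin

definition lie_subalgebra :: "'a set \<Rightarrow> bool" where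
  "lie_subalgebra M \<longleftrightarrow> M \<subseteq> L \<and> subspace M \<and> (\<forall>x\<in>M. \<forall>y\<in>M. bracket x y \<in> M)"

definition generates :: "'a set \<Rightarrow> bool" where
  "generates X \<longleftrightarrow> X \<subseteq> L \<and> lie_subalgebra hull X = L"

definition finitely_generated :: bool where
  "finitely_generated \<longleftrightarrow> (\<exists>X. finite X \<and> generates X)"

text \<open>
  \<open>product_of X m x\<close>: \<open>x\<close> is the value of some arrangement of parentheses on a product of
  exactly \<open>m\<close> elements of \<open>X\<close> (there is no empty product, so \<open>m \<ge> 1\<close>).
\<close>

inductive product_of :: "'a set \<Rightarrow> nat \<Rightarrow> 'a \<Rightarrow> bool" for X where
  gen: "x \<in> X \<Longrightarrow> product_of X 1 x"
| bracket: "\<lbrakk>product_of X m x; product_of X n y\<rbrakk> \<Longrightarrow> product_of X (m + n) (bracket x y)"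

definition products_upto :: "'a set \<Rightarrow> nat \<Rightarrow> 'a set" where
  "products_upto X n = {x. \<exists>m\<le>n. product_of X m x}"

definition growth :: "'a set \<Rightarrow> nat \<Rightarrow> nat" where
  "growth X n = dim (span (products_upto X n))"

end

text \<open>Functions are considered at arguments \<open>n \<ge> 1\<close> only; their value at 0 is irrelevant.\<close>

definition growth_le :: "(nat \<Rightarrow> nat) \<Rightarrow> (nat \<Rightarrow> nat) \<Rightarrow> bool" where
  "growth_le f g \<longleftrightarrow>
    (\<exists>C::real. \<exists>D::nat. C > 0 \<and> D > 0 \<and> (\<forall>n\<ge>1. real (f n) \<le> C * real (g (D * n))))"

definition growth_equiv :: "(nat \<Rightarrow> nat) \<Rightarrow> (nat \<Rightarrow> nat) \<Rightarrow> bool" where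
  "growth_equiv f g \<longleftrightarrow> growth_le f g \<and> growth_le g f"

definition polynomially_bounded :: "(nat \<Rightarrow> nat) \<Rightarrow> bool" where
  "polynomially_bounded f \<longleftrightarrow>
    (\<exists>K d::real. K > 0 \<and> d > 0 \<and> (\<forall>n\<ge>1. real (f n) \<le> K * real n powr d))"

text \<open>
  HOL cannot quantify existentially over types, so a type must be fixed in which Lie algebras
  are sought. A finitely generated algebra has countable dimension, hence is isomorphic to one
  whose underlying vector space is a subspace of the space of all sequences over the field.
\<close>

definition seq_scale :: "'k::field \<Rightarrow> (nat \<Rightarrow> 'k) \<Rightarrow> nat \<Rightarrow> 'k" where
  "seq_scale c v = (\<lambda>i. c * v i)"

lemma vector_space_seq_scale: "vector_space seq_scale"
  by unfold_locales (auto simp: seq_scale_def fun_eq_iff algebra_simps)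

end

theory Submission
  imports Defs "HOL-Library.Multiset" "HOL-Library.Countable_Set"
begin

text \<open>
  Let \<open>H\<close> be the Lie algebra with basis \<open>x, v\<^sub>0, v\<^sub>1, \<dots>\<close>, where \<open>[x, v\<^sub>j] = v\<^bsub>j+1\<^esub>\<close> and the \<open>v\<^sub>j\<close> commute. It
  has linear growth, while its enveloping algebra has the basis \<open>x\<^sup>a w\<close>, with \<open>w\<close> a monomial in the
  \<open>v\<^sub>j\<close>, and grows faster than any polynomial. Let \<open>x\<close> have degree 1 and \<open>v\<^sub>j\<close> degree \<open>j + 1\<close>. For a
  nondecreasing \<open>r\<close>, the \<open>x\<^sup>a w\<close> such that \<open>w\<close> has more than \<open>d\<close> factors, or contains a factor \<open>v\<^sub>u\<close>
  with \<open>u < r n\<close>, where \<open>n\<close> is one more than the degree of \<open>x\<^sup>a w\<close>, span a left ideal. The Lie algebra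
  sought is the semidirect product \<open>L\<close> of \<open>H\<close> with the quotient \<open>M\<close>, made abelian; it is generated by
  \<open>x\<close>, \<open>v\<^sub>0\<close> and the image of 1 in \<open>M\<close>.

  It remains to choose \<open>r\<close>. It is kept constant as long as the total dimension does not exceed the
  target \<open>f\<close>; otherwise \<open>r n\<close> is set to \<open>n\<close>, which kills everything in degree \<open>n\<close> except one element.
  As the homogeneous components at most double from one degree to the next, the dimension is within
  a factor 3 of \<open>f\<close> whenever this happens. If it does not happen between \<open>n\<close> and \<open>D n\<close>, then the
  products of \<open>d\<close> factors \<open>v\<^sub>u\<close> with \<open>u \<ge> n\<close> already give dimension at least \<open>n\<^sup>d\<close>.
\<close>

subsection \<open>Independence of the generating set\<close>

context lie_algebra
begin

lemma bracket_zero_left: "y \<in> L \<Longrightarrow> bracket 0 y = 0"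
  using bracket_scale_left[of y y 0] by simp

lemma bracket_zero_right: "x \<in> L \<Longrightarrow> bracket x 0 = 0"
  using bracket_scale_right[of x x 0] by simp

lemma bracket_in_span:
  assumes "S \<subseteq> L" "T \<subseteq> L" "\<And>s t. s \<in> S \<Longrightarrow> t \<in> T \<Longrightarrow> bracket s t \<in> span U"
    and x: "x \<in> span S" and y: "y \<in> span T"
  shows "bracket x y \<in> span U"
proof -
  have span_L: "span S \<subseteq> L" "span T \<subseteq> L"
    using assms subspace_carrier by (simp_all add: span_minimal)
  have gen: "bracket s y \<in> span U" if s: "s \<in> S" for s
  proof -
    have sL: "s \<in> L" using s assms by blast
    \<comment> \<open>Membership in \<open>L\<close> is carried through the induction because
      bilinearity is only available there.\<close>
    from y have "y \<in> L \<and> bracket s y \<in> span U"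
    proof (induction rule: span_induct_alt)
      case base
      then show ?case using sL by (simp add: bracket_zero_right span_zero subspace_0[OF subspace_carrier])
    next
      case (step c t z)
      have tL: "t \<in> L" using step assms by blast
      then have "scale c t \<in> L" by (rule subspace_scale[OF subspace_carrier])
      with step tL sL show ?case
        by (auto simp: bracket_add_right bracket_scale_right subspace_add[OF subspace_carrier]
            intro!: span_add span_scale assms(3) s)
    qed
    then show ?thesis by blast
  qed
  have yL: "y \<in> L" using y span_L by blast
  from x have "x \<in> L \<and> bracket x y \<in> span U"
  proof (induction rule: span_induct_alt)
    case base
    then show ?case using yL by (simp add: bracket_zero_left span_zero subspace_0[OF subspace_carrier])
  next
    case (step c t z)
    have tL: "t \<in> L" using step assms by blast
    then have "scale c t \<in> L" by (rule subspace_scale[OF subspace_carrier])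
    with step tL yL show ?case
      by (auto simp: bracket_add_left bracket_scale_left subspace_add[OF subspace_carrier]
          intro!: span_add span_scale gen)
  qed
  then show ?thesis by blast
qed

lemma product_of_pos: "product_of X m x \<Longrightarrow> m > 0"
  by (induction rule: product_of.induct) auto

lemma product_of_subset:
  assumes "product_of X m x" "X \<subseteq> M" "lie_subalgebra M"
  shows "x \<in> M"
  using assms by (induction rule: product_of.induct) (auto simp: lie_subalgebra_def)

lemma lie_subalgebra_carrier: "lie_subalgebra L"
  using subspace_carrier bracket_closed by (auto simp: lie_subalgebra_def)

lemma products_upto_subset:
  assumes "X \<subseteq> M" "lie_subalgebra M"
  shows "products_upto X n \<subseteq> M"
  using product_of_subset[OF _ assms] by (auto simp: products_upto_def)

lemma products_upto_mono: "m \<le> n \<Longrightarrow> products_upto X m \<subseteq> products_upto X n"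
  unfolding products_upto_def by auto (meson le_trans)

text \<open>Lengths are positive, so both factors of a bracket are strictly shorter and strong
  induction on the length applies.\<close>

lemma finite_product_of:
  assumes "finite X"
  shows "finite {x. product_of X m x}"
proof (induction m rule: less_induct)
  case (less m)
  let ?P = "\<lambda>i. {x. product_of X i x}"
  let ?Q = "\<lambda>(i, j). (\<lambda>(x, y). bracket x y) ` (?P i \<times> ?P j)"
  have "?P m \<subseteq> X \<union> \<Union>(?Q ` ({..<m} \<times> {..<m}))"
  proof
    fix z assume "z \<in> ?P m"
    then have "product_of X m z" by simp
    then show "z \<in> X \<union> \<Union>(?Q ` ({..<m} \<times> {..<m}))"
    proof cases
      case gen
      then show ?thesis by simp
    next
      case (bracket i x j y)
      then have "(i, j) \<in> {..<m} \<times> {..<m}" "z \<in> ?Q (i, j)"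
        by (auto dest: product_of_pos)
      then show ?thesis by blast
    qed
  qed
  moreover have "finite (X \<union> \<Union>(?Q ` ({..<m} \<times> {..<m})))"
    using less assms by auto
  ultimately show ?case by (rule finite_subset)
qed

lemma finite_products_upto: "finite X \<Longrightarrow> finite (products_upto X n)"
proof -
  assume "finite X"
  moreover have "products_upto X n = (\<Union>m\<le>n. {x. product_of X m x})"
    by (auto simp: products_upto_def)
  ultimately show ?thesis using finite_product_of by simp
qed

text \<open>Finiteness of \<open>T\<close> matters: an infinite basis has \<open>card\<close> 0, so
  \<open>dim\<close> is not monotone in general.\<close>

lemma dim_span_le:
  assumes "finite T" "S \<subseteq> span T"
  shows "dim (span S) \<le> dim (span T)"
proof -
  obtain B where B: "B \<subseteq> T" "independent B" "T \<subseteq> span B" "card B = dim T"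
    using basis_exists by blast
  have "span S \<subseteq> span T" using assms by (simp add: span_minimal)
  also have "\<dots> \<subseteq> span B" using B by (simp add: span_minimal)
  finally have "dim (span S) \<le> card B"
    using B assms(1) by (intro dim_le_card) (auto intro: finite_subset)
  then show ?thesis using B by (simp add: dim_span)
qed

lemma bracket_span_products_upto:
  assumes "X \<subseteq> L" "x \<in> span (products_upto X m)" "y \<in> span (products_upto X n)"
  shows "bracket x y \<in> span (products_upto X (m + n))"
proof (rule bracket_in_span[OF _ _ _ assms(2,3)])
  show "products_upto X m \<subseteq> L" "products_upto X n \<subseteq> L"
    using assms(1) lie_subalgebra_carrier by (simp_all add: products_upto_subset)
  fix s t assume "s \<in> products_upto X m" "t \<in> products_upto X n"
  then obtain i j where "i \<le> m" "product_of X i s" "j \<le> n" "product_of X j t"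
    by (auto simp: products_upto_def)
  then have "i + j \<le> m + n" "product_of X (i + j) (bracket s t)"
    by (auto intro: product_of.bracket)
  then have "bracket s t \<in> products_upto X (m + n)"
    unfolding products_upto_def by blast
  then show "bracket s t \<in> span (products_upto X (m + n))" by (rule span_base)
qed

text \<open>The spans increase with \<open>n\<close>, so their union is a subspace; it is closed
  under brackets since lengths add.\<close>

lemma hull_eq_Union_span_products:
  assumes "X \<subseteq> L"
  shows "lie_subalgebra hull X = (\<Union>n. span (products_upto X n))" (is "_ = ?U")
proof (rule hull_unique)
  show "X \<subseteq> ?U"
    using product_of.gen[of _ X] by (auto simp: products_upto_def intro!: exI[of _ 1] span_base)
  have "subspace ?U"
  proof (rule subspaceI)
    show "0 \<in> ?U" by (auto intro: span_zero)
    fix x y assume "x \<in> ?U" "y \<in> ?U"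
    then obtain m n where mn: "x \<in> span (products_upto X m)" "y \<in> span (products_upto X n)" by blast
    have "x \<in> span (products_upto X (max m n))" "y \<in> span (products_upto X (max m n))"
      using mn span_mono[OF products_upto_mono[of m "max m n" X]]
        span_mono[OF products_upto_mono[of n "max m n" X]] by auto
    then show "x + y \<in> ?U" by (blast intro: span_add)
  next
    fix c x assume "x \<in> ?U"
    then show "scale c x \<in> ?U" by (blast intro: span_scale)
  qed
  moreover have "?U \<subseteq> L"
    using products_upto_subset[OF assms lie_subalgebra_carrier]
    by (intro UN_least span_minimal subspace_carrier)
  moreover have "bracket x y \<in> ?U" if "x \<in> ?U" "y \<in> ?U" for x y
  proof -
    from that obtain m n where "x \<in> span (products_upto X m)" "y \<in> span (products_upto X n)" by blast
    then have "bracket x y \<in> span (products_upto X (m + n))"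
      by (rule bracket_span_products_upto[OF assms])
    then show ?thesis by blast
  qed
  ultimately show "lie_subalgebra ?U"
    unfolding lie_subalgebra_def by blast
next
  fix M assume M: "X \<subseteq> M" "lie_subalgebra M"
  then have "subspace M" by (simp add: lie_subalgebra_def)
  then show "?U \<subseteq> M"
    using products_upto_subset[OF M] by (intro UN_least span_minimal)
qed

lemma growth_le_growth:
  assumes X: "finite X" "generates X" and Y: "finite Y" "Y \<subseteq> L"
  shows "growth_le (growth Y) (growth X)"
proof -
  have XL: "X \<subseteq> L" using X by (simp add: generates_def)
  have "\<exists>m. y \<in> span (products_upto X m)" if "y \<in> Y" for y
    using that X(2) Y(2) hull_eq_Union_span_products[OF XL] by (auto simp: generates_def)
  then obtain m where m: "\<And>y. y \<in> Y \<Longrightarrow> y \<in> span (products_upto X (m y))"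
    by metis
  \<comment> \<open>The sum bounds every \<open>m y\<close>; \<open>Suc\<close> keeps
    \<open>D\<close> positive even if \<open>Y\<close> is empty. A product of \<open>k\<close>
    elements of \<open>Y\<close> then needs length at most \<open>D * k\<close> over
    \<open>X\<close>.\<close>
  define D where "D = Suc (\<Sum>y\<in>Y. m y)"
  have "m y \<le> D" if "y \<in> Y" for y
    using member_le_sum[of y Y m] that Y by (simp add: D_def)
  then have D: "y \<in> span (products_upto X D)" if "y \<in> Y" for y
    using m[OF that] that span_mono[OF products_upto_mono[of "m y" D X]] by auto
  have prod: "x \<in> span (products_upto X (D * k))" if "product_of Y k x" for k x
    using that
  proof induction
    case (gen x)
    then show ?case using D by simp
  next
    case (bracket i x j y)
    then show ?case
      using bracket_span_products_upto[OF XL, of x "D * i" y "D * j"] by (simp add: distrib_left)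
  qed
  have sub: "products_upto Y n \<subseteq> span (products_upto X (D * n))" for n
  proof
    fix x assume "x \<in> products_upto Y n"
    then obtain k where "k \<le> n" "product_of Y k x" by (auto simp: products_upto_def)
    with prod show "x \<in> span (products_upto X (D * n))"
      using span_mono[OF products_upto_mono[of "D * k" "D * n" X]] by auto
  qed
  have "growth Y n \<le> growth X (D * n)" for n
    unfolding growth_def by (rule dim_span_le[OF finite_products_upto[OF X(1)] sub])
  then show ?thesis
    unfolding growth_le_def by (intro exI[of _ 1] exI[of _ D]) (simp add: D_def)
qed

lemma growth_equiv_growth:
  assumes "finite X" "generates X" "finite Y" "generates Y"
  shows "growth_equiv (growth X) (growth Y)"
  using assms growth_le_growth[of X Y] growth_le_growth[of Y X]
  by (simp add: growth_equiv_def generates_def)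

end

lemma growth_le_trans:
  assumes "growth_le f g" "growth_le g h"
  shows "growth_le f h"
proof -
  obtain C D where f: "C > 0" "D > 0" "\<And>n. n \<ge> 1 \<Longrightarrow> real (f n) \<le> C * real (g (D * n))"
    using assms(1) by (auto simp: growth_le_def)
  obtain C' D' where g: "C' > 0" "D' > 0" "\<And>n. n \<ge> 1 \<Longrightarrow> real (g n) \<le> C' * real (h (D' * n))"
    using assms(2) by (auto simp: growth_le_def)
  have "real (f n) \<le> C * C' * real (h (D' * D * n))" if "n \<ge> 1" for n
  proof -
    have "real (g (D * n)) \<le> C' * real (h (D' * (D * n)))"
      using f(2) that by (intro g(3)) simp
    then have "C * real (g (D * n)) \<le> C * (C' * real (h (D' * (D * n))))"
      using f(1) by (intro mult_left_mono) auto
    with f(3)[OF that] show ?thesis by (simp add: mult_ac)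
  qed
  moreover have "C * C' > 0" "D' * D > 0" using f g by simp_all
  ultimately show ?thesis unfolding growth_le_def by blast
qed

lemma growth_equiv_trans: "growth_equiv f g \<Longrightarrow> growth_equiv g h \<Longrightarrow> growth_equiv f h"
  unfolding growth_equiv_def by (blast intro: growth_le_trans)

subsection \<open>The semidirect product\<close>

text \<open>Countability lets the basis be indexed by natural numbers, as the ambient space of
  sequences requires. A multiset is encoded through a chosen list of its elements.\<close>

instance multiset :: (countable) countable
proof
  have "inj (\<lambda>m :: 'a multiset. to_nat (SOME xs. mset xs = m))"
    by (rule injI) (metis (mono_tags) ex_mset someI_ex to_nat_split)
  then show "\<exists>to_nat :: 'a multiset \<Rightarrow> nat. inj to_nat" by blast
qed

text \<open>
  \<open>CX\<close> stands for \<open>x\<close>, \<open>CV j\<close> for \<open>v\<^sub>j = (ad x)\<^sup>j v\<close>, and \<open>CM a w\<close> for \<open>x\<^sup>a\<close> times the product of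
  the \<open>v\<^sub>u\<close>, \<open>u \<in># w\<close>, applied to the module generator.
\<close>

datatype cell = CX | CV nat | CM nat "nat multiset"

instance cell :: countable
  by countable_datatype

definition weight :: "nat multiset \<Rightarrow> nat" where
  "weight w = (\<Sum>u\<in>#w. Suc u)"

lemma weight_simps [simp]:
  "weight {#} = 0"
  "weight (add_mset u w) = Suc u + weight w"
  by (simp_all add: weight_def)

lemma weight_remove: "u \<in># w \<Longrightarrow> weight w = Suc u + weight (w - {#u#})"
  by (metis insert_DiffM weight_simps(2))

lemma less_weight: "u \<in># w \<Longrightarrow> u < weight w"
  using weight_remove by fastforce

lemma weight_ge_size: "size w \<le> weight w"
  by (induction w) auto

text \<open>Elements of the enveloping algebra are given by their coefficients \<open>h a w\<close>
  at x^a w; this is left multiplication by x.\<close>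

definition x_act :: "(nat \<Rightarrow> nat multiset \<Rightarrow> 'k::comm_ring_1) \<Rightarrow> nat \<Rightarrow> nat multiset \<Rightarrow> 'k" where
  "x_act h a w = (if a = 0 then 0 else h (a - 1) w)"

text \<open>
  This is \<open>v\<^sub>j x\<^sup>a = (\<Sum>i\<le>a. (-1)\<^sup>i (a choose i) x\<^bsup>a-i\<^esup> v\<^bsub>i+j\<^esub>)\<close>, read coefficientwise. In this form every
  coefficient is a finite sum, so the bracket is defined on all functions, not only on those with
  finite support.
\<close>

definition v_act ::
  "(nat \<Rightarrow> 'k::comm_ring_1) \<Rightarrow> (nat \<Rightarrow> nat multiset \<Rightarrow> 'k) \<Rightarrow> nat \<Rightarrow> nat multiset \<Rightarrow> 'k" where
  "v_act p h a w =
    (\<Sum>u\<in>set_mset w. \<Sum>i\<le>u. (- 1) ^ i * of_nat ((a + i) choose i) * p (u - i) * h (a + i) (w - {#u#}))"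

text \<open>This is ad x on the span of the v_j, in coefficients.\<close>

definition shift :: "(nat \<Rightarrow> 'k::zero) \<Rightarrow> nat \<Rightarrow> 'k" where
  "shift p j = (case j of 0 \<Rightarrow> 0 | Suc i \<Rightarrow> p i)"

lemma shift_simps [simp]: "shift p 0 = 0" "shift p (Suc i) = p i"
  by (simp_all add: shift_def)

section \<open>Relations of H in its enveloping algebra\<close>

lemma x_act_linear: "x_act (\<lambda>a w. c * h a w + h' a w) a w = c * x_act h a w + x_act h' a w"
  by (simp add: x_act_def)

lemma v_act_linear: "v_act p (\<lambda>a w. c * h a w + h' a w) a w = c * v_act p h a w + v_act p h' a w"
  by (simp add: v_act_def sum_distrib_left flip: sum.distrib) (simp add: algebra_simps)

lemma v_act_linear_left:
  "v_act (\<lambda>j. c * p j + p' j) h a w = c * v_act p h a w + v_act p' h a w"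
  by (simp add: v_act_def sum_distrib_left flip: sum.distrib) (simp add: algebra_simps)

lemma x_act_v_act: "x_act (v_act p h) a w = v_act p (x_act h) a w + v_act (shift p) h a w"
proof -
  \<comment> \<open>The identity x v = v x + [x, v] already holds for each removed factor
    \<open>u\<close> separately. For \<open>a > 0\<close> it is Pascal's rule, after the
    \<open>i = 0\<close> term is split off.\<close>
  have *: "(if a = 0 then 0 else \<Sum>i\<le>u. (- 1) ^ i * of_nat ((a - 1 + i) choose i) * p (u - i) * h (a - 1 + i) w')
     = (\<Sum>i\<le>u. (- 1) ^ i * of_nat ((a + i) choose i) * p (u - i) * x_act h (a + i) w')
     + (\<Sum>i\<le>u. (- 1) ^ i * of_nat ((a + i) choose i) * shift p (u - i) * h (a + i) w')"
    (is "?l = ?m + ?r") for u w'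
  proof (cases u)
    case 0
    then show ?thesis by (simp add: x_act_def)
  next
    case (Suc t)
    have r: "?r = (\<Sum>i\<le>t. (- 1) ^ i * of_nat ((a + i) choose i) * p (t - i) * h (a + i) w')"
      unfolding Suc sum.atMost_Suc by (auto simp: Suc_diff_le intro!: sum.cong)
    have m: "?m = p u * x_act h a w' - (\<Sum>i\<le>t. (- 1) ^ i * of_nat ((a + Suc i) choose Suc i) * p (t - i) * h (a + i) w')"
      unfolding Suc sum.atMost_Suc_shift by (simp add: x_act_def sum_negf)
    show ?thesis
    proof (cases a)
      case 0
      then show ?thesis unfolding m r by (simp add: x_act_def)
    next
      case (Suc b)
      have l: "?l = p u * h b w' - (\<Sum>i\<le>t. (- 1) ^ i * of_nat ((b + Suc i) choose Suc i) * p (t - i) * h (a + i) w')"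
        unfolding \<open>u = Suc t\<close> sum.atMost_Suc_shift using Suc by (simp add: sum_negf)
      show ?thesis
        unfolding l m r using Suc
        by (simp add: x_act_def algebra_simps flip: sum.distrib)
    qed
  qed
  have "x_act (v_act p h) a w = (\<Sum>u\<in>set_mset w. (if a = 0 then 0 else
      \<Sum>i\<le>u. (- 1) ^ i * of_nat ((a - 1 + i) choose i) * p (u - i) * h (a - 1 + i) (w - {#u#})))"
    by (simp add: x_act_def v_act_def)
  also have "\<dots> = v_act p (x_act h) a w + v_act (shift p) h a w"
    unfolding * v_act_def sum.distrib ..
  finally show ?thesis .
qed

text \<open>Both sides are the trinomial coefficient (a+i+j)! / (a! i! j!).\<close>

lemma binomial_swap:
  "((a + i) choose i) * ((a + i + j) choose j) = ((a + j) choose j) * ((a + j + i) choose i)"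
proof -
  have "((a + i) choose i) * ((a + i + j) choose j) * (fact a * fact i * fact j)
      = (((a + i) choose i) * (fact i * fact a)) * ((a + i + j) choose j) * fact j"
    by (simp only: mult_ac)
  also have "\<dots> = fact (a + i + j)"
    using binomial_fact_lemma[of i "a + i"] binomial_fact_lemma[of j "a + i + j"] by (simp add: mult_ac)
  also have "\<dots> = fact (a + j + i)" by (simp add: add_ac)
  also have "\<dots> = (((a + j) choose j) * (fact j * fact a)) * ((a + j + i) choose i) * fact i"
    using binomial_fact_lemma[of j "a + j"] binomial_fact_lemma[of i "a + j + i"] by (simp add: mult_ac)
  also have "\<dots> = ((a + j) choose j) * ((a + j + i) choose i) * (fact a * fact i * fact j)"
    by (simp only: mult_ac)
  finally show ?thesis by simp
qed

lemma v_act_commute: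
  fixes p :: "nat \<Rightarrow> 'k::comm_ring_1"
  shows "v_act p (v_act q h) a w = v_act q (v_act p h) a w"
proof -
  define F :: "(nat \<Rightarrow> 'k) \<Rightarrow> (nat \<Rightarrow> 'k) \<Rightarrow> nat \<Rightarrow> nat \<Rightarrow> 'k" where "F p q u u' = (\<Sum>i\<le>u. \<Sum>j\<le>u'. (- 1) ^ (i + j) *
     of_nat (((a + i) choose i) * ((a + i + j) choose j)) * p (u - i) * q (u' - j) *
     h (a + i + j) (w - {#u#} - {#u'#}))" for p q u u'
  have expand: "v_act p (v_act q h) a w = (\<Sum>(u, u')\<in>Sigma (set_mset w) (\<lambda>u. set_mset (w - {#u#})). F p q u u')" for p q
  proof -
    have "v_act p (v_act q h) a w = (\<Sum>u\<in>set_mset w. \<Sum>i\<le>u. \<Sum>u'\<in>set_mset (w - {#u#}). \<Sum>j\<le>u'.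
       (- 1) ^ (i + j) * of_nat (((a + i) choose i) * ((a + i + j) choose j)) * p (u - i) * q (u' - j) *
       h (a + i + j) (w - {#u#} - {#u'#}))"
      unfolding v_act_def sum_distrib_left
      by (intro sum.cong refl) (simp add: power_add mult_ac)
    also have "\<dots> = (\<Sum>u\<in>set_mset w. \<Sum>u'\<in>set_mset (w - {#u#}). F p q u u')"
      unfolding F_def by (intro sum.cong refl sum.swap)
    also have "\<dots> = (\<Sum>(u, u')\<in>Sigma (set_mset w) (\<lambda>u. set_mset (w - {#u#})). F p q u u')"
      by (rule sum.Sigma) auto
    finally show ?thesis .
  qed
  have sym: "F p q u u' = F q p u' u" for u u'
  proof -
    have "F p q u u' = (\<Sum>j\<le>u'. \<Sum>i\<le>u. (- 1) ^ (i + j) *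
     of_nat (((a + i) choose i) * ((a + i + j) choose j)) * p (u - i) * q (u' - j) *
     h (a + i + j) (w - {#u#} - {#u'#}))"
      unfolding F_def by (rule sum.swap)
    also have "\<dots> = F q p u' u"
      unfolding F_def
    proof (intro sum.cong refl)
      fix i j
      show "(- 1) ^ (i + j) * of_nat (((a + i) choose i) * ((a + i + j) choose j)) * p (u - i) * q (u' - j) *
            h (a + i + j) (w - {#u#} - {#u'#}) =
          (- 1) ^ (j + i) * of_nat (((a + j) choose j) * ((a + j + i) choose i)) * q (u' - j) * p (u - i) *
            h (a + j + i) (w - {#u'#} - {#u#})"
        by (subst binomial_swap) (simp only: add_ac mult_ac diff_right_commute[of w "{#u#}"])
    qed
    finally show ?thesis .
  qed
  \<comment> \<open>The index set of ordered pairs is symmetric: it says that both factors can be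
    removed together, so u = u' requires multiplicity two.\<close>
  have "u \<in># w \<and> u' \<in># w - {#u#} \<longleftrightarrow> {#u, u'#} \<subseteq># w" for u u'
    by (simp add: insert_subset_eq_iff)
  then have mem: "u' \<in># w \<and> u \<in># w - {#u'#}" if "u \<in># w" "u' \<in># w - {#u#}" for u u'
    using that by (metis add_mset_commute)
  show ?thesis
    unfolding expand
    by (rule sum.reindex_bij_witness[of _ prod.swap prod.swap]) (auto simp: sym dest: mem)
qed

text \<open>The \<open>CM\<close> coefficients of \<open>g\<close> do not enter, which makes the
  module an abelian ideal of the semidirect product.\<close>

definition h_act ::
  "(cell \<Rightarrow> 'k::comm_ring_1) \<Rightarrow> (nat \<Rightarrow> nat multiset \<Rightarrow> 'k) \<Rightarrow> nat \<Rightarrow> nat multiset \<Rightarrow> 'k" where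
  "h_act g h a w = g CX * x_act h a w + v_act (\<lambda>j. g (CV j)) h a w"

lemma h_act_cong:
  assumes "a > 0 \<Longrightarrow> h (a - 1) w = h' (a - 1) w"
    and "\<And>u i. u \<in># w \<Longrightarrow> i \<le> u \<Longrightarrow> h (a + i) (w - {#u#}) = h' (a + i) (w - {#u#})"
  shows "h_act g h a w = h_act g h' a w"
  using assms unfolding h_act_def x_act_def v_act_def by (auto intro!: sum.cong arg_cong2[of _ _ _ _ "(+)"])

lemma h_act_nonzeroE:
  assumes "h_act g h a w \<noteq> 0"
  obtains "a > 0" "g CX \<noteq> 0" "h (a - 1) w \<noteq> 0"
  | u i where "u \<in># w" "i \<le> u" "g (CV (u - i)) \<noteq> 0" "h (a + i) (w - {#u#}) \<noteq> 0"
proof -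
  have "g CX * x_act h a w \<noteq> 0 \<or> v_act (\<lambda>j. g (CV j)) h a w \<noteq> 0"
    using assms unfolding h_act_def by auto
  then show thesis
  proof
    assume "g CX * x_act h a w \<noteq> 0"
    then show thesis by (intro that(1)) (auto simp: x_act_def split: if_splits)
  next
    assume "v_act (\<lambda>j. g (CV j)) h a w \<noteq> 0"
    then obtain u i where "u \<in># w" "i \<le> u"
      "(- 1) ^ i * of_nat ((a + i) choose i) * g (CV (u - i)) * h (a + i) (w - {#u#}) \<noteq> 0"
      unfolding v_act_def by (meson atMost_iff sum.not_neutral_contains_not_neutral)
    then show thesis by (intro that(2)[of u i]) auto
  qed
qed

definition v_bracket :: "(cell \<Rightarrow> 'k::comm_ring_1) \<Rightarrow> (cell \<Rightarrow> 'k) \<Rightarrow> nat \<Rightarrow> 'k" where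
  "v_bracket g g' j = g CX * shift (\<lambda>i. g' (CV i)) j - g' CX * shift (\<lambda>i. g (CV i)) j"

text \<open>The module axiom for H. The x-x and v-v terms cancel; the mixed ones are given by
  \<open>x_act_v_act\<close>.\<close>

lemma h_act_commutator:
  "h_act g (h_act g' h) a w - h_act g' (h_act g h) a w = v_act (v_bracket g g') h a w"
proof -
  have "v_bracket g g' = (\<lambda>j. g CX * shift (\<lambda>i. g' (CV i)) j + (- g' CX * shift (\<lambda>i. g (CV i)) j + 0))"
    by (simp add: v_bracket_def fun_eq_iff)
  then have "v_act (v_bracket g g') h a w = g CX * v_act (shift (\<lambda>i. g' (CV i))) h a w
      - g' CX * v_act (shift (\<lambda>i. g (CV i))) h a w"
    by (simp only: v_act_linear_left) (simp add: v_act_def)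
  moreover have "v_act p (\<lambda>a w. h_act g h a w) a w = g CX * v_act p (x_act h) a w + v_act p (v_act (\<lambda>j. g (CV j)) h) a w" for p g
    unfolding h_act_def v_act_linear ..
  moreover have "x_act (\<lambda>a w. h_act g h a w) a w = g CX * x_act (x_act h) a w + x_act (v_act (\<lambda>j. g (CV j)) h) a w" for g
    unfolding h_act_def x_act_linear ..
  ultimately show ?thesis
    by (simp add: h_act_def[of g "h_act g' h"] h_act_def[of g' "h_act g h"] x_act_v_act
        v_act_commute[of "\<lambda>j. g (CV j)" "\<lambda>j. g' (CV j)"] algebra_simps)
qed

text \<open>
  \<open>CM a w\<close> has degree \<open>Suc (a + weight w)\<close>. The cells that are not alive span a submodule because \<open>r\<close> is
  monotone and removing a factor from \<open>w\<close> lowers the degree.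
\<close>

locale truncation =
  fixes d :: nat and r :: "nat \<Rightarrow> nat"
  assumes mono_r: "mono r"
begin

definition alive :: "nat \<Rightarrow> nat multiset \<Rightarrow> bool" where
  "alive a w \<longleftrightarrow> size w \<le> d \<and> (\<forall>u\<in>#w. r (Suc (a + weight w)) \<le> u)"

lemma alive_antimono:
  assumes "alive a w" "a' + weight w' \<le> a + weight w" "w' \<subseteq># w"
  shows "alive a' w'"
proof -
  have "r (Suc (a' + weight w')) \<le> r (Suc (a + weight w))"
    using assms(2) by (intro monoD[OF mono_r]) simp
  then show ?thesis
    using assms(1,3) size_mset_mono[OF assms(3)] unfolding alive_def
    by (meson le_trans mset_subset_eqD)
qed

lemma alive_diff: "alive a w \<Longrightarrow> alive (a - 1) w"
  by (rule alive_antimono) auto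

lemma alive_remove: "alive a w \<Longrightarrow> u \<in># w \<Longrightarrow> i \<le> u \<Longrightarrow> alive (a + i) (w - {#u#})"
  by (rule alive_antimono) (auto simp: weight_remove)

text \<open>The quotient by the cells that are not alive is represented by functions vanishing on
  them.\<close>

definition act :: "(cell \<Rightarrow> 'k::comm_ring_1) \<Rightarrow> (nat \<Rightarrow> nat multiset \<Rightarrow> 'k) \<Rightarrow> nat \<Rightarrow> nat multiset \<Rightarrow> 'k" where
  "act g h a w = (if alive a w then h_act g h a w else 0)"

text \<open>Coefficients at alive cells only depend on coefficients at alive cells, so truncating
  once at the end is enough.\<close>

lemma act_act: "act g (act g' h) a w = (if alive a w then h_act g (h_act g' h) a w else 0)"
  unfolding act_def by (auto intro!: h_act_cong dest: alive_diff alive_remove)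

definition cell_bracket :: "(cell \<Rightarrow> 'k::comm_ring_1) \<Rightarrow> (cell \<Rightarrow> 'k) \<Rightarrow> cell \<Rightarrow> 'k" where
  "cell_bracket g g' b = (case b of
      CX \<Rightarrow> 0
    | CV j \<Rightarrow> v_bracket g g' j
    | CM a w \<Rightarrow> act g (\<lambda>a w. g' (CM a w)) a w - act g' (\<lambda>a w. g (CM a w)) a w)"

lemma cell_bracket_simps [simp]:
  "cell_bracket g g' CX = 0"
  "cell_bracket g g' (CV j) = v_bracket g g' j"
  "cell_bracket g g' (CM a w) = act g (\<lambda>a w. g' (CM a w)) a w - act g' (\<lambda>a w. g (CM a w)) a w"
  by (simp_all add: cell_bracket_def)

lemma act_linear: "act g (\<lambda>a w. c * h a w + h' a w) a w = c * act g h a w + act g h' a w"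
  by (simp only: act_def h_act_def x_act_linear v_act_linear) (simp add: algebra_simps)

lemma act_linear_left: "act (\<lambda>b. c * g b + g' b) h a w = c * act g h a w + act g' h a w"
  by (simp only: act_def h_act_def v_act_linear_left) (simp add: algebra_simps)

lemma cell_bracket_linear:
  "cell_bracket (\<lambda>b. c * g b + g' b) k b = c * cell_bracket g k b + cell_bracket g' k b"
proof (cases b)
  case (CV j)
  then show ?thesis by (cases j) (simp_all add: v_bracket_def algebra_simps)
next
  case (CM a w)
  then show ?thesis by (simp only: cell_bracket_simps act_linear act_linear_left) (simp add: algebra_simps)
qed simp

lemma cell_bracket_antisym: "cell_bracket g g' b = - cell_bracket g' g b"
  by (cases b) (simp_all add: v_bracket_def)

lemma act_bracket:
  "act (cell_bracket g g') h a w = act g (act g' h) a w - act g' (act g h) a w"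
  unfolding act_act by (simp add: act_def h_act_commutator) (simp add: h_act_def)

lemma act_cell_bracket:
  "act x (\<lambda>a w. cell_bracket y z (CM a w)) a w =
    act x (act y (\<lambda>a w. z (CM a w))) a w - act x (act z (\<lambda>a w. y (CM a w))) a w"
proof -
  have "(\<lambda>a w. cell_bracket y z (CM a w)) =
     (\<lambda>a w. (- 1) * act z (\<lambda>a w. y (CM a w)) a w + act y (\<lambda>a w. z (CM a w)) a w)"
    by (simp add: fun_eq_iff)
  then show ?thesis by (simp only: act_linear) simp
qed

text \<open>On \<open>CM\<close> cells the module axiom turns every term into a twofold action, and
  these cancel in pairs.\<close>

lemma cell_bracket_jacobi:
  "cell_bracket x (cell_bracket y z) b + cell_bracket y (cell_bracket z x) b
    + cell_bracket z (cell_bracket x y) b = 0"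
proof (cases b)
  case CX
  then show ?thesis by simp
next
  case (CV j)
  then show ?thesis
    by (auto simp: v_bracket_def shift_def algebra_simps split: nat.split)
next
  case (CM a w)
  show ?thesis
    unfolding CM cell_bracket_simps(3)[of x "cell_bracket y z"] cell_bracket_simps(3)[of y "cell_bracket z x"]
      cell_bracket_simps(3)[of z "cell_bracket x y"] act_cell_bracket act_bracket
    by simp
qed

end

subsection \<open>The greedy threshold\<close>

text \<open>If \<open>s\<close> is the threshold at degree \<open>n\<close>, this indexes the alive
  \<open>CM\<close> cells of degree \<open>n\<close>: the exponent of x must be
  \<open>n - 1 - weight w\<close>.\<close>

definition level :: "nat \<Rightarrow> nat \<Rightarrow> nat \<Rightarrow> nat multiset set" where
  "level d s n = {w. size w \<le> d \<and> weight w < n \<and> (\<forall>u\<in>#w. s \<le> u)}"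

lemma finite_weight_less: "finite {w. weight w < n}"
proof (rule finite_subset)
  show "{w. weight w < n} \<subseteq> mset ` {xs. set xs \<subseteq> {..<n} \<and> length xs \<le> n}"
  proof
    fix w assume w: "w \<in> {w. weight w < n}"
    obtain xs where xs: "w = mset xs" using ex_mset by metis
    have "set xs \<subseteq> {..<n}" using w less_weight[of _ w] by (fastforce simp: xs)
    moreover have "length xs \<le> n" using w weight_ge_size[of w] by (simp add: xs)
    ultimately show "w \<in> mset ` {xs. set xs \<subseteq> {..<n} \<and> length xs \<le> n}" using xs by blast
  qed
qed (simp add: finite_lists_length_le)

lemma finite_level: "finite (level d s n)"
  by (rule finite_subset[OF _ finite_weight_less[of n]]) (auto simp: level_def)

lemma level_trivial:
  assumes "n \<le> Suc s" "n > 0"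
  shows "level d s n = {{#}}"
proof -
  have "w = {#}" if "w \<in> level d s n" for w
  proof (rule ccontr)
    assume "w \<noteq> {#}"
    then obtain u where "u \<in># w" by blast
    with that less_weight[of u w] assms show False by (fastforce simp: level_def)
  qed
  with assms show ?thesis by (auto simp: level_def)
qed

lemma level_mono: "m \<le> n \<Longrightarrow> level d s m \<subseteq> level d s n"
  by (auto simp: level_def)

lemma card_level_Suc:
  assumes "n > 0"
  shows "card (level d s (Suc n)) \<le> 2 * card (level d s n)"
proof -
  \<comment> \<open>A monomial of weight exactly \<open>n\<close> is determined by what remains after removing its largest
    index, since the weight gives that index back.\<close>
  let ?N = "level d s (Suc n) - level d s n"
  let ?f = "\<lambda>w. w - {#Max_mset w#}"
  have N: "weight w = n" "Max_mset w \<in># w" if "w \<in> ?N" for w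
  proof -
    show "weight w = n" using that by (auto simp: level_def)
    with assms have "w \<noteq> {#}" by auto
    then show "Max_mset w \<in># w" by simp
  qed
  have "inj_on ?f ?N"
  proof (rule inj_onI)
    fix w w' assume w: "w \<in> ?N" "w' \<in> ?N" "?f w = ?f w'"
    have "n = Suc (Max_mset w) + weight (?f w)" "n = Suc (Max_mset w') + weight (?f w')"
      using N[OF w(1)] N[OF w(2)] weight_remove by metis+
    then have "Max_mset w = Max_mset w'" using w(3) by simp
    then show "w = w'" using w N by (metis insert_DiffM)
  qed
  moreover have "?f ` ?N \<subseteq> level d s n"
  proof
    fix v assume "v \<in> ?f ` ?N"
    then obtain w where w: "w \<in> ?N" "v = ?f w" by blast
    have "weight v < n" using weight_remove[OF N(2)[OF w(1)]] N(1)[OF w(1)] w(2) by simp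
    moreover have "size v \<le> size w" using w(2) by (simp add: size_mset_mono)
    ultimately show "v \<in> level d s n"
      using w by (auto simp: level_def dest: in_diffD)
  qed
  ultimately have "card ?N \<le> card (level d s n)"
    by (rule card_inj_on_le[OF _ _ finite_level])
  moreover have "card (level d s (Suc n)) \<le> card (level d s n) + card ?N"
    using card_Un_le[of "level d s n" ?N] level_mono[of n "Suc n" d s] by (simp add: Un_absorb1)
  ultimately show ?thesis by simp
qed

lemma card_level_ge:
  assumes "s \<le> n" "d > 0" "n > 0" "N > d * (n + d * n)"
  shows "n ^ d \<le> card (level d s N)"
proof -
  \<comment> \<open>Square-free monomials suffice. A window of length \<open>d * n\<close> gives (d
    n choose d) of them, at least (d n / d)^d = n^d, and each factor has degree at most
    \<open>n + d * n\<close>.\<close>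
  let ?S = "{S. S \<subseteq> {n..<n + d * n} \<and> card S = d}"
  have sub: "mset_set ` ?S \<subseteq> level d s N"
  proof (rule image_subsetI)
    fix S assume S: "S \<in> ?S"
    then have fin: "finite S" using finite_subset by blast
    have "weight (mset_set S) = (\<Sum>u\<in>S. Suc u)"
      by (simp add: weight_def sum_unfold_sum_mset)
    also have "\<dots> \<le> (\<Sum>u\<in>S. n + d * n)" using S by (intro sum_mono) auto
    also have "\<dots> < N" using S assms by simp
    finally show "mset_set S \<in> level d s N"
      using S assms fin by (auto simp: level_def)
  qed
  have inj: "inj_on mset_set ?S"
    by (rule inj_onI) (metis (mono_tags, lifting) finite_atLeastLessThan finite_set_mset_mset_set finite_subset mem_Collect_eq)
  have "card ?S \<le> card (level d s N)"
    by (rule card_inj_on_le[OF inj sub finite_level])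
  moreover have "card ?S = (d * n) choose d"
    by (subst n_subsets) auto
  moreover have "real n ^ d \<le> real ((d * n) choose d)"
    using binomial_ge_n_over_k_pow_k[of d "d * n", where 'a = real] assms by simp
  ultimately show ?thesis
    by (metis of_nat_le_iff of_nat_power order_trans)
qed

text \<open>
  \<open>greedy d f n\<close> is the pair of the threshold at degree \<open>n\<close> and of the total size of the levels up
  to \<open>n\<close>. A threshold \<open>\<ge> n - 1\<close> leaves only the empty monomial at degree \<open>n\<close>.
\<close>

fun greedy :: "nat \<Rightarrow> (nat \<Rightarrow> nat) \<Rightarrow> nat \<Rightarrow> nat \<times> nat" where
  "greedy d f 0 = (0, 0)"
| "greedy d f (Suc n) = (case greedy d f n of (s, t) \<Rightarrow>
     if t + card (level d s (Suc n)) \<le> f (Suc n) + 1 then (s, t + card (level d s (Suc n)))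
     else (Suc n, Suc t))"

lemma fst_greedy_le: "fst (greedy d f n) \<le> n"
  by (induction n) (auto split: prod.split)

lemma mono_fst_greedy: "mono (\<lambda>n. fst (greedy d f n))"
  unfolding mono_iff_le_Suc
proof
  fix n
  show "fst (greedy d f n) \<le> fst (greedy d f (Suc n))"
    using fst_greedy_le[of d f n] by (auto split: prod.split)
qed

lemma snd_greedy: "snd (greedy d f n) = (\<Sum>i=1..n. card (level d (fst (greedy d f i)) i))"
proof (induction n)
  case (Suc n)
  then show ?case by (auto split: prod.split simp: level_trivial)
qed simp

text \<open>Raising the threshold adds only 1 to the total, which the strict growth of
  \<open>f\<close> absorbs.\<close>

lemma snd_greedy_le:
  assumes "strict_mono_on {1..} f" "n \<ge> 1"
  shows "snd (greedy d f n) \<le> f n + 1"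
  using assms(2)
proof (induction n rule: dec_induct)
  \<comment> \<open>The slack \<open>+ 1\<close> is for this case: \<open>f 1\<close> may be 0,
    while the module generator already counts.\<close>
  case base
  then show ?case by (simp add: level_trivial)
next
  case (step n)
  have "f n < f (Suc n)" using step by (intro strict_mono_onD[OF assms(1)]) auto
  then show ?case using step.IH by (auto split: prod.split)
qed

text \<open>A raise means that the next level would have overshot \<open>f\<close>. That level is at
  most twice the current one, which is itself part of the total; hence 3 = 1 + 2.\<close>

lemma greedy_raise:
  assumes "fst (greedy d f (Suc n)) \<noteq> fst (greedy d f n)" "n \<ge> 1"
  shows "f (Suc n) \<le> 3 * snd (greedy d f n)"
proof -
  obtain s t where st: "greedy d f n = (s, t)" by fastforce
  have "f (Suc n) \<le> t + card (level d s (Suc n))"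
    using assms st by (auto split: if_splits)
  also have "\<dots> \<le> t + 2 * card (level d s n)"
    using card_level_Suc[of n d s] assms(2) by simp
  also have "card (level d s n) \<le> t"
  proof -
    have "card (level d (fst (greedy d f n)) n) \<le> snd (greedy d f n)"
      unfolding snd_greedy using assms(2)
      by (intro member_le_sum[of n "{1..n}" "\<lambda>i. card (level d (fst (greedy d f i)) i)"]) auto
    then show ?thesis by (simp add: st)
  qed
  finally show ?thesis by (simp add: st)
qed

lemma mono_snd_greedy: "m \<le> n \<Longrightarrow> snd (greedy d f m) \<le> snd (greedy d f n)"
  unfolding snd_greedy by (rule sum_mono2) auto

lemma le_snd_greedy:
  assumes f: "strict_mono_on {1..} f" and d: "d > 0" and n: "n \<ge> 1"
  shows "f n \<le> 3 * snd (greedy d f ((d * (d + 1) + 1) * n))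
    \<or> n ^ d \<le> snd (greedy d f ((d * (d + 1) + 1) * n))"
proof -
  \<comment> \<open>Chosen so that \<open>N\<close> exceeds \<open>d * (n + d * n)\<close>, as
    \<open>card_level_ge\<close> requires.\<close>
  define N where "N = (d * (d + 1) + 1) * n"
  have N: "N = d * (n + d * n) + n" by (simp add: N_def algebra_simps)
  then have "n \<le> N" by simp
  have "f n \<le> 3 * snd (greedy d f N) \<or> n ^ d \<le> snd (greedy d f N)"
  proof (cases "\<exists>t\<in>{n..<N}. fst (greedy d f (Suc t)) \<noteq> fst (greedy d f t)")
    case True
    then obtain t where t: "n \<le> t" "t < N" "fst (greedy d f (Suc t)) \<noteq> fst (greedy d f t)" by auto
    have "f n \<le> f (Suc t)"
      using t n by (intro less_imp_le strict_mono_onD[OF f]) auto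
    also have "\<dots> \<le> 3 * snd (greedy d f t)"
      using t n by (intro greedy_raise) auto
    also have "\<dots> \<le> 3 * snd (greedy d f N)"
      using t by (intro mult_left_mono mono_snd_greedy) auto
    finally show ?thesis ..
  next
    case False
    \<comment> \<open>Without a raise, the threshold at \<open>N\<close> is still the one at
      \<open>n\<close>, hence at most \<open>n\<close>.\<close>
    have "n \<le> m \<Longrightarrow> m \<le> N \<Longrightarrow> fst (greedy d f m) = fst (greedy d f n)" for m
    proof (induction m rule: dec_induct)
      case (step m)
      then have "m \<in> {n..<N}" by simp
      with False step show ?case by simp
    qed simp
    from this[OF _ order_refl] have "fst (greedy d f N) = fst (greedy d f n)" using \<open>n \<le> N\<close> .
    then have "fst (greedy d f N) \<le> n" using fst_greedy_le[of d f n] by simp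
    then have "n ^ d \<le> card (level d (fst (greedy d f N)) N)"
      using n d by (intro card_level_ge) (simp_all add: N)
    also have "\<dots> \<le> snd (greedy d f N)"
      unfolding snd_greedy using n N
      by (intro member_le_sum[of N "{1..N}" "\<lambda>i. card (level d (fst (greedy d f i)) i)"]) auto
    finally show ?thesis ..
  qed
  then show ?thesis unfolding N_def .
qed

lemma strict_mono_on_ge:
  assumes "strict_mono_on {1..} f" "n \<ge> 1"
  shows "n \<le> f n + (1 :: nat)"
  using assms(2)
proof (induction n rule: dec_induct)
  case (step n)
  have "f n < f (Suc n)" using step by (intro strict_mono_onD[OF assms(1)]) auto
  with step.IH show ?case by simp
qed simp

text \<open>The summand \<open>1 + n\<close> is the share of H: x and v_0, ..., v_(n-1).\<close>

lemma growth_equiv_greedy: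
  assumes f: "strict_mono_on {1..} f" and "polynomially_bounded f"
  shows "\<exists>d. growth_equiv (\<lambda>n. 1 + n + snd (greedy d f n)) f"
proof -
  obtain K e :: real where K: "K > 0" "e > 0" "\<And>n. n \<ge> 1 \<Longrightarrow> real (f n) \<le> K * real n powr e"
    using assms(2) by (auto simp: polynomially_bounded_def)
  define d where "d = nat \<lceil>e\<rceil>"
  have d: "d > 0" "e \<le> real d" using K(2) by (simp_all add: d_def)
  let ?F = "\<lambda>n. 1 + n + snd (greedy d f n)"
  have "growth_le ?F f"
    unfolding growth_le_def
  proof (intro exI conjI allI impI)
    fix n :: nat assume n: "n \<ge> 1"
    \<comment> \<open>Since \<open>f 1\<close> may be 0, the argument is dilated: f(3n) is at least
      3n - 1, which absorbs the linear part.\<close>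
    have "f n < f (3 * n)" using n by (intro strict_mono_onD[OF f]) auto
    moreover have "3 * n \<le> f (3 * n) + 1" using n by (intro strict_mono_on_ge[OF f]) simp
    moreover have "snd (greedy d f n) \<le> f n + 1" by (rule snd_greedy_le[OF f n])
    ultimately have "?F n \<le> 4 * f (3 * n)" using n by simp
    then show "real (?F n) \<le> 4 * real (f (3 * n))" by linarith
  qed simp_all
  moreover have "growth_le f ?F"
    unfolding growth_le_def
  proof (intro exI conjI allI impI)
    fix n :: nat assume n: "n \<ge> 1"
    let ?N = "(d * (d + 1) + 1) * n"
    consider "f n \<le> 3 * snd (greedy d f ?N)" | "n ^ d \<le> snd (greedy d f ?N)"
      using le_snd_greedy[OF f d(1) n] by blast
    then have "real (f n) \<le> (3 + K) * real (snd (greedy d f ?N))"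
    proof cases
      case 1
      then have "real (f n) \<le> 3 * real (snd (greedy d f ?N))" by linarith
      also have "\<dots> \<le> (3 + K) * real (snd (greedy d f ?N))"
        using K(1) by (intro mult_right_mono) auto
      finally show ?thesis .
    next
      case 2
      have "real (f n) \<le> K * real n powr e" using K(3) n by blast
      also have "\<dots> \<le> K * real n powr real d"
        using n d(2) K(1) by (intro mult_left_mono powr_mono) auto
      also have "\<dots> = K * real (n ^ d)" using n by (simp add: powr_realpow)
      also have "\<dots> \<le> (3 + K) * real (snd (greedy d f ?N))"
        using 2 K(1) by (intro mult_mono of_nat_mono) auto
      finally show ?thesis .
    qed
    also have "\<dots> \<le> (3 + K) * real (?F ?N)"
      using K(1) by (intro mult_left_mono of_nat_mono) auto
    finally show "real (f n) \<le> (3 + K) * real (?F ((d * (d + 1) + 1) * n))" .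
  next
    show "3 + K > 0" using K(1) by simp
  qed simp
  ultimately show ?thesis by (auto simp: growth_equiv_def)
qed

subsection \<open>Growth of the semidirect product\<close>

primrec grade :: "cell \<Rightarrow> nat" where
  "grade CX = 1"
| "grade (CV j) = Suc j"
| "grade (CM a w) = Suc (a + weight w)"

section \<open>Cells as coordinates of sequences\<close>

definition idx :: "cell \<Rightarrow> nat" where
  "idx = to_nat_on UNIV"

lemma infinite_cell: "infinite (UNIV :: cell set)"
proof -
  have "infinite (range CV)"
    by (simp add: finite_image_iff inj_def)
  then show ?thesis by (rule contrapos_nn) (rule finite_subset[OF subset_UNIV])
qed

lemma bij_idx: "bij idx"
  unfolding idx_def by (rule to_nat_on_infinite[OF _ infinite_cell]) simp

lemma idx_eq_iff [simp]: "idx b = idx b' \<longleftrightarrow> b = b'"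
  using bij_idx by (auto dest: bij_is_inj injD)

lemma inv_idx [simp]: "inv idx (idx b) = b"
  using bij_idx by (simp add: bij_is_inj)

lemma seq_eq_iff: "z = z' \<longleftrightarrow> (\<forall>b. z (idx b) = z' (idx b))"
  by (metis bij_idx bij_pointE ext)

definition unit_seq :: "cell \<Rightarrow> nat \<Rightarrow> 'k::field" where
  "unit_seq b n = (if n = idx b then 1 else 0)"

lemma unit_seq_idx [simp]: "unit_seq b (idx b') = (if b' = b then 1 else 0)"
  by (simp add: unit_seq_def)

lemma inj_unit_seq: "inj (unit_seq :: cell \<Rightarrow> nat \<Rightarrow> 'k::field)"
  by (rule injI) (metis unit_seq_idx zero_neq_one)

interpretation seq: vector_space seq_scale
  by (rule vector_space_seq_scale)

text \<open>The coordinate at \<open>b\<close> vanishes on the span of the other unit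
  sequences.\<close>

lemma independent_unit_seq: "seq.independent (unit_seq ` S :: (nat \<Rightarrow> 'k::field) set)"
  unfolding seq.dependent_def
proof clarify
  fix b :: cell
  assume "(unit_seq b :: nat \<Rightarrow> 'k) \<in> seq.span (unit_seq ` S - {unit_seq b})"
  moreover have "seq.span (unit_seq ` S - {unit_seq b}) \<subseteq> {z :: nat \<Rightarrow> 'k. z (idx b) = 0}"
  proof (rule seq.span_minimal)
    show "seq.subspace {z :: nat \<Rightarrow> 'k. z (idx b) = 0}"
      by (auto intro!: seq.subspaceI simp: seq_scale_def)
  qed auto
  ultimately show False by auto
qed

lemma seq_in_span_unit_seq:
  fixes z :: "nat \<Rightarrow> 'k::field"
  assumes "finite S" "\<And>b. z (idx b) \<noteq> 0 \<Longrightarrow> b \<in> S"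
  shows "z \<in> seq.span (unit_seq ` S)"
proof -
  have sum_apply: "(\<Sum>b\<in>S. seq_scale (z (idx b)) (unit_seq b)) n = (\<Sum>b\<in>S. z (idx b) * unit_seq b n)" for n
    using assms(1) by induction (simp_all add: seq_scale_def)
  have "z (idx c) = (\<Sum>b\<in>S. z (idx b) * unit_seq b (idx c))" for c
  proof -
    have "(\<Sum>b\<in>S. z (idx b) * unit_seq b (idx c)) = (\<Sum>b\<in>S. if c = b then z (idx b) else 0)"
      by (intro sum.cong) auto
    then show ?thesis using assms by auto
  qed
  then have "z = (\<Sum>b\<in>S. seq_scale (z (idx b)) (unit_seq b))"
    unfolding seq_eq_iff sum_apply by blast
  moreover have "(\<Sum>b\<in>S. seq_scale (z (idx b)) (unit_seq b)) \<in> seq.span (unit_seq ` S)"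
    by (intro seq.span_sum seq.span_scale seq.span_base imageI)
  ultimately show ?thesis by simp
qed

context truncation
begin

section \<open>The degree filtration and its dimensions\<close>

definition cells :: "nat \<Rightarrow> cell set" where
  "cells n = {b. grade b \<le> n \<and> (\<forall>a w. b = CM a w \<longrightarrow> alive a w)}"

lemma cells_simps [simp]:
  "CX \<in> cells n \<longleftrightarrow> 1 \<le> n"
  "CV j \<in> cells n \<longleftrightarrow> Suc j \<le> n"
  "CM a w \<in> cells n \<longleftrightarrow> Suc (a + weight w) \<le> n \<and> alive a w"
  by (auto simp: cells_def)

lemma cells_mono: "m \<le> n \<Longrightarrow> cells m \<subseteq> cells n"
  by (auto simp: cells_def)

text \<open>An alive \<open>CM\<close> cell is recorded by its degree and its monomial, so that the
  count becomes a sum of level sizes.\<close>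

lemma cells_eq:
  assumes "n > 0"
  shows "cells n = insert CX (CV ` {..<n} \<union>
    (\<lambda>(i, w). CM (i - Suc (weight w)) w) ` Sigma {1..n} (\<lambda>i. level d (r i) i))"
    (is "_ = insert CX (?V \<union> ?f ` ?S)")
proof (rule set_eqI)
  fix b
  show "b \<in> cells n \<longleftrightarrow> b \<in> insert CX (?V \<union> ?f ` ?S)"
  proof (cases b)
    case (CM a w)
    have "CM a w \<in> ?f ` ?S" if "CM a w \<in> cells n"
      using that
      by (intro image_eqI[of _ _ "(Suc (a + weight w), w)"]) (auto simp: level_def alive_def)
    moreover have "CM a w \<in> cells n" if "CM a w \<in> ?f ` ?S"
      using that by (auto simp: level_def alive_def)
    moreover have "CM a w \<noteq> CX" "CM a w \<notin> CV ` {..<n}" by auto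
    ultimately show ?thesis unfolding CM by blast
  qed (use assms in auto)
qed

lemma finite_cells: "finite (cells n)"
proof (cases "n = 0")
  case True
  have "grade b > 0" for b by (cases b) auto
  then have "cells n = {}" using True by (auto simp: cells_def)
  then show ?thesis by simp
qed (simp add: cells_eq finite_level)

lemma card_cells:
  assumes "n > 0"
  shows "card (cells n) = 1 + n + (\<Sum>i=1..n. card (level d (r i) i))"
proof -
  let ?f = "\<lambda>(i, w). CM (i - Suc (weight w)) w"
  let ?S = "Sigma {1..n} (\<lambda>i. level d (r i) i)"
  have "inj_on ?f ?S"
    by (auto simp: inj_on_def level_def)
  then have "card (?f ` ?S) = (\<Sum>i=1..n. card (level d (r i) i))"
    by (simp add: card_image card_SigmaI finite_level)
  moreover have "card (CV ` {..<n}) = n"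
    by (simp add: card_image inj_on_def)
  moreover have "CX \<notin> CV ` {..<n} \<union> ?f ` ?S" "CV ` {..<n} \<inter> ?f ` ?S = {}" "finite ?S"
    by (auto simp: finite_level)
  ultimately show ?thesis
    unfolding cells_eq[OF assms] by (simp add: card_Un_disjoint)
qed

text \<open>The action is homogeneous: trading v_u for x^i lowers the degree by u - i + 1, the
  degree of the acting v_(u-i).\<close>

lemma act_support:
  assumes "act g h a w \<noteq> 0"
    and g: "\<And>b. g b \<noteq> 0 \<Longrightarrow> b \<in> cells m"
    and h: "\<And>a w. h a w \<noteq> 0 \<Longrightarrow> CM a w \<in> cells n"
  shows "CM a w \<in> cells (m + n)"
proof -
  have "alive a w" "h_act g h a w \<noteq> 0"
    using assms(1) by (auto simp: act_def split: if_splits)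
  from this(2) show ?thesis
  proof (cases rule: h_act_nonzeroE)
    case 1
    then show ?thesis using \<open>alive a w\<close> g[of CX] h[of "a - 1" w] by auto
  next
    case (2 u i)
    then show ?thesis
      using \<open>alive a w\<close> g[of "CV (u - i)"] h[of "a + i" "w - {#u#}"] weight_remove[of u w] by auto
  qed
qed

lemma v_bracket_support:
  assumes "v_bracket g g' j \<noteq> 0"
    and g: "\<And>b. g b \<noteq> 0 \<Longrightarrow> b \<in> cells m"
    and g': "\<And>b. g' b \<noteq> 0 \<Longrightarrow> b \<in> cells n"
  shows "CV j \<in> cells (m + n)"
proof (cases j)
  case (Suc i)
  then have "(g CX \<noteq> 0 \<and> g' (CV i) \<noteq> 0) \<or> (g' CX \<noteq> 0 \<and> g (CV i) \<noteq> 0)"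
    using assms(1) by (auto simp: v_bracket_def)
  then show ?thesis
    using Suc g[of CX] g[of "CV i"] g'[of CX] g'[of "CV i"] by auto
qed (use assms(1) in \<open>simp add: v_bracket_def\<close>)

lemma cell_bracket_support:
  assumes "cell_bracket g g' b \<noteq> 0"
    and g: "\<And>b. g b \<noteq> 0 \<Longrightarrow> b \<in> cells m"
    and g': "\<And>b. g' b \<noteq> 0 \<Longrightarrow> b \<in> cells n"
  shows "b \<in> cells (m + n)"
proof (cases b)
  case CX
  then show ?thesis using assms(1) by simp
next
  case (CV j)
  then show ?thesis using assms(1) v_bracket_support[OF _ g g'] by simp
next
  case (CM a w)
  then have "act g (\<lambda>a w. g' (CM a w)) a w \<noteq> 0 \<or> act g' (\<lambda>a w. g (CM a w)) a w \<noteq> 0"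
    using assms(1) by auto
  then show ?thesis
  proof
    assume "act g (\<lambda>a w. g' (CM a w)) a w \<noteq> 0"
    then show ?thesis unfolding CM by (rule act_support[OF _ g g'])
  next
    assume "act g' (\<lambda>a w. g (CM a w)) a w \<noteq> 0"
    then show ?thesis unfolding CM add.commute[of m] by (rule act_support[OF _ g' g])
  qed
qed

section \<open>The Lie algebra of sequences\<close>

definition seq_bracket :: "(nat \<Rightarrow> 'k::field) \<Rightarrow> (nat \<Rightarrow> 'k) \<Rightarrow> nat \<Rightarrow> 'k" where
  "seq_bracket z z' n = cell_bracket (\<lambda>b. z (idx b)) (\<lambda>b. z' (idx b)) (inv idx n)"

lemma seq_bracket_idx [simp]:
  "seq_bracket z z' (idx b) = cell_bracket (\<lambda>b. z (idx b)) (\<lambda>b. z' (idx b)) b"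
  by (simp add: seq_bracket_def)

text \<open>As \<open>cells n\<close> is finite, these are the finitely supported sequences avoiding
  the cells that are not alive.\<close>

definition carrier :: "(nat \<Rightarrow> 'k::field) set" where
  "carrier = {z. \<exists>n. \<forall>b. z (idx b) \<noteq> 0 \<longrightarrow> b \<in> cells n}"

lemma subspace_carrier: "seq.subspace carrier"
proof (rule seq.subspaceI)
  fix z z' :: "nat \<Rightarrow> 'k::field" and c :: 'k
  assume "z \<in> carrier"
  then obtain m where m: "\<And>b. z (idx b) \<noteq> 0 \<Longrightarrow> b \<in> cells m" by (auto simp: carrier_def)
  then show "seq_scale c z \<in> carrier" by (auto simp: carrier_def seq_scale_def)
  assume "z' \<in> carrier"
  then obtain n where n: "\<And>b. z' (idx b) \<noteq> 0 \<Longrightarrow> b \<in> cells n" by (auto simp: carrier_def)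
  have "b \<in> cells (max m n)" if "(z + z') (idx b) \<noteq> 0" for b
  proof -
    have "z (idx b) \<noteq> 0 \<or> z' (idx b) \<noteq> 0" using that by auto
    then show ?thesis
      using m[of b] n[of b] cells_mono[of m "max m n"] cells_mono[of n "max m n"] by auto
  qed
  then show "z + z' \<in> carrier" unfolding carrier_def by blast
qed (simp add: carrier_def)

lemma seq_bracket_linear:
  "seq_bracket (seq_scale c x + y) z = seq_scale c (seq_bracket x z) + seq_bracket y z"
  by (simp add: seq_eq_iff seq_scale_def cell_bracket_linear)

lemma seq_bracket_antisym: "seq_bracket x y = - seq_bracket y x"
  using cell_bracket_antisym by (auto simp: seq_eq_iff)

text \<open>Proved directly, since antisymmetry does not give it in characteristic 2.\<close>

lemma cell_bracket_alternating: "cell_bracket g g b = 0"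
  by (cases b) (simp_all add: v_bracket_def)

lemma seq_bracket_alternating: "seq_bracket x x = 0"
  by (simp add: seq_eq_iff cell_bracket_alternating)

lemma seq_bracket_carrier:
  assumes "x \<in> carrier" "y \<in> carrier"
  shows "seq_bracket x y \<in> carrier"
proof -
  obtain m where m: "\<And>b. x (idx b) \<noteq> 0 \<Longrightarrow> b \<in> cells m"
    using assms by (auto simp: carrier_def)
  obtain n where n: "\<And>b. y (idx b) \<noteq> 0 \<Longrightarrow> b \<in> cells n"
    using assms by (auto simp: carrier_def)
  have "b \<in> cells (m + n)" if "seq_bracket x y (idx b) \<noteq> 0" for b
    using that by (intro cell_bracket_support[OF _ m n]) simp_all
  then show ?thesis unfolding carrier_def by blast
qed

lemma lie_algebra_seq: "lie_algebra seq_scale (carrier :: (nat \<Rightarrow> 'k::field) set) seq_bracket"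
proof (intro lie_algebra.intro lie_algebra_axioms.intro vector_space_seq_scale subspace_carrier
    seq_bracket_carrier seq_bracket_alternating)
  fix x y z :: "nat \<Rightarrow> 'k" and c :: 'k
  show add: "seq_bracket (x + y) z = seq_bracket x z + seq_bracket y z" for x y z :: "nat \<Rightarrow> 'k"
    using seq_bracket_linear[of 1 x y z] by simp
  show "seq_bracket x (y + z) = seq_bracket x y + seq_bracket x z"
    by (simp add: seq_bracket_antisym[of x] add)
  have "seq_bracket 0 y = 0" for y :: "nat \<Rightarrow> 'k"
    using add[of 0 0 y] by simp
  then show scale: "seq_bracket (seq_scale c x) y = seq_scale c (seq_bracket x y)" for x y :: "nat \<Rightarrow> 'k"
    using seq_bracket_linear[of c x 0 y] by simp
  show "seq_bracket x (seq_scale c y) = seq_scale c (seq_bracket x y)"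
    by (simp add: seq_bracket_antisym[of x] scale)
  show "seq_bracket x (seq_bracket y z) + seq_bracket y (seq_bracket z x)
      + seq_bracket z (seq_bracket x y) = 0"
    by (simp add: seq_eq_iff cell_bracket_jacobi)
qed

sublocale lie: lie_algebra seq_scale carrier seq_bracket
  by (rule lie_algebra_seq)

section \<open>Products of the generators\<close>

definition generators :: "(nat \<Rightarrow> 'k::field) set" where
  "generators = unit_seq ` {CX, CV 0, CM 0 {#}}"

lemma product_of_support:
  assumes "lie.product_of generators n z" "z (idx b) \<noteq> 0"
  shows "b \<in> cells n"
  using assms
proof (induction arbitrary: b)
  case (gen z)
  then show ?case by (auto simp: generators_def alive_def split: if_splits)
next
  case (bracket m x n y)
  then show ?case by (intro cell_bracket_support[OF _ bracket.IH]) auto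
qed

lemma act_zero [simp]: "act g (\<lambda>a w. 0) a w = 0"
  by (simp add: act_def h_act_def x_act_def v_act_def)

lemma bracket_unit_CX_CV:
  "seq_bracket (unit_seq CX) (unit_seq (CV j)) = unit_seq (CV (Suc j))"
  unfolding seq_eq_iff
proof
  fix c
  show "seq_bracket (unit_seq CX) (unit_seq (CV j)) (idx c) = unit_seq (CV (Suc j)) (idx c)"
    by (cases c) (auto simp: v_bracket_def shift_def split: nat.split)
qed

lemma bracket_unit_CX_CM:
  assumes "alive (Suc a) w"
  shows "seq_bracket (unit_seq CX) (unit_seq (CM a w)) = unit_seq (CM (Suc a) w)"
  unfolding seq_eq_iff
proof
  fix c
  show "seq_bracket (unit_seq CX) (unit_seq (CM a w)) (idx c) = unit_seq (CM (Suc a) w) (idx c)"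
    using assms
    by (cases c) (auto simp: v_bracket_def shift_def act_def h_act_def v_act_def x_act_def split: nat.split)
qed

text \<open>On a pure monomial in the v_j, multiplication by v_u just adds a factor; the terms with
  \<open>i > 0\<close> would need a positive power of x.\<close>

lemma v_act_unit:
  assumes "u \<in># w"
  shows "v_act (\<lambda>j. if j = u then 1 else 0) (\<lambda>a' w'. if a' = 0 \<and> w' = w - {#u#} then 1 else 0) a v
    = (if a = 0 \<and> v = w then 1 else 0)"
proof -
  have inner: "(\<Sum>i\<le>t. (- 1) ^ i * of_nat ((a + i) choose i) * (if t - i = u then 1 else 0) *
      (if a + i = 0 \<and> v - {#t#} = w - {#u#} then 1 else 0)) =
    (if t = u then if a = 0 \<and> v - {#u#} = w - {#u#} then 1 else 0 else 0)" (is "?l = ?r") for t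
  proof -
    have "?l = (\<Sum>i\<le>t. if i = 0 then ?r else 0)"
      by (intro sum.cong) auto
    then show ?thesis by simp
  qed
  have "v = w" if "u \<in># v" "v - {#u#} = w - {#u#}"
    using that assms by (metis insert_DiffM)
  then show ?thesis
    unfolding v_act_def inner using assms by (auto simp del: insert_DiffM)
qed

lemma bracket_unit_CV_CM:
  assumes "alive 0 w" "u \<in># w"
  shows "seq_bracket (unit_seq (CV u)) (unit_seq (CM 0 (w - {#u#}))) = unit_seq (CM 0 w)"
  unfolding seq_eq_iff
proof
  fix c
  show "seq_bracket (unit_seq (CV u)) (unit_seq (CM 0 (w - {#u#}))) (idx c) = unit_seq (CM 0 w) (idx c)"
    using assms
    by (cases c) (auto simp: v_bracket_def shift_def act_def h_act_def v_act_unit split: nat.split)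
qed

lemma product_of_CV: "lie.product_of generators (Suc j) (unit_seq (CV j))"
proof (induction j)
  case 0
  show ?case using lie.product_of.gen[of "unit_seq (CV 0)" generators] by (simp add: generators_def)
next
  case (Suc j)
  have "lie.product_of generators 1 (unit_seq CX)"
    by (rule lie.product_of.gen) (simp add: generators_def)
  from lie.product_of.bracket[OF this Suc] show ?case by (simp add: bracket_unit_CX_CV)
qed

text \<open>The factors are applied one by one to the module generator. Every intermediate monomial
  is alive, so nothing is truncated, and v_u costs u + 1 generators.\<close>

lemma product_of_CM_0: "alive 0 w \<Longrightarrow> lie.product_of generators (Suc (weight w)) (unit_seq (CM 0 w))"
proof (induction w)
  case empty
  show ?case using lie.product_of.gen[of "unit_seq (CM 0 {#})" generators] by (simp add: generators_def)
next
  case (add u w)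
  have "alive 0 w" by (rule alive_antimono[OF add.prems]) auto
  from lie.product_of.bracket[OF product_of_CV[of u] add.IH[OF this]]
  show ?case by (simp add: bracket_unit_CV_CM[OF add.prems, of u, simplified] add_ac)
qed

lemma product_of_CM: "alive a w \<Longrightarrow> lie.product_of generators (Suc (a + weight w)) (unit_seq (CM a w))"
proof (induction a)
  case 0
  then show ?case using product_of_CM_0 by simp
next
  case (Suc a)
  have "lie.product_of generators 1 (unit_seq CX)"
    by (rule lie.product_of.gen) (simp add: generators_def)
  moreover have "alive a w" using alive_diff[OF Suc.prems] by simp
  ultimately show ?case
    using lie.product_of.bracket[OF _ Suc.IH, of 1 "unit_seq CX"] by (simp add: bracket_unit_CX_CM Suc.prems)
qed

lemma product_of_unit_seq: "b \<in> cells n \<Longrightarrow> lie.product_of generators (grade b) (unit_seq b)"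
  using lie.product_of.gen[of "unit_seq CX" generators]
  by (cases b) (simp_all add: product_of_CV product_of_CM, simp add: generators_def)

text \<open>Length and degree filtrations coincide: brackets add degrees, and each alive cell is a
  product of exactly \<open>grade b\<close> generators.\<close>

lemma span_products_upto:
  "seq.span (lie.products_upto generators n) = seq.span (unit_seq ` cells n :: (nat \<Rightarrow> 'k::field) set)"
proof (rule antisym; rule seq.span_minimal[OF _ seq.subspace_span]; rule subsetI)
  fix z :: "nat \<Rightarrow> 'k"
  assume "z \<in> lie.products_upto generators n"
  then obtain m where m: "m \<le> n" "lie.product_of generators m z" by (auto simp: lie.products_upto_def)
  then have "b \<in> cells n" if "z (idx b) \<noteq> 0" for b
    using product_of_support that cells_mono[of m n] by blast
  then show "z \<in> seq.span (unit_seq ` cells n)"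
    by (intro seq_in_span_unit_seq finite_cells)
next
  fix z :: "nat \<Rightarrow> 'k"
  assume "z \<in> unit_seq ` cells n"
  then obtain b where "b \<in> cells n" "z = unit_seq b" by blast
  then show "z \<in> seq.span (lie.products_upto generators n)"
    using product_of_unit_seq by (intro seq.span_base) (auto simp: lie.products_upto_def cells_def)
qed

lemma growth_generators: "lie.growth (generators :: (nat \<Rightarrow> 'k::field) set) n = card (cells n)"
proof -
  have "lie.growth (generators :: (nat \<Rightarrow> 'k) set) n = card (unit_seq ` cells n :: (nat \<Rightarrow> 'k) set)"
    unfolding lie.growth_def span_products_upto
    by (simp add: seq.dim_eq_card_independent independent_unit_seq)
  also have "\<dots> = card (cells n)"
    by (intro card_image inj_on_subset[OF inj_unit_seq]) simp
  finally show ?thesis .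
qed

lemma generates_generators: "lie.generates (generators :: (nat \<Rightarrow> 'k::field) set)"
proof -
  have sub: "generators \<subseteq> (carrier :: (nat \<Rightarrow> 'k) set)"
    using product_of_support[OF lie.product_of.gen] unfolding carrier_def by blast
  have "carrier \<subseteq> (\<Union>n. seq.span (lie.products_upto generators n) :: (nat \<Rightarrow> 'k) set)"
  proof
    fix z :: "nat \<Rightarrow> 'k"
    assume "z \<in> carrier"
    then obtain n where "\<And>b. z (idx b) \<noteq> 0 \<Longrightarrow> b \<in> cells n" by (auto simp: carrier_def)
    then have "z \<in> seq.span (unit_seq ` cells n)" by (intro seq_in_span_unit_seq finite_cells)
    then show "z \<in> (\<Union>n. seq.span (lie.products_upto generators n))"
      unfolding span_products_upto by blast
  qed
  moreover have "lie.lie_subalgebra hull generators \<subseteq> (carrier :: (nat \<Rightarrow> 'k) set)"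
    using sub lie.lie_subalgebra_carrier by (rule hull_minimal)
  ultimately show ?thesis
    using sub lie.hull_eq_Union_span_products[OF sub] unfolding lie.generates_def by blast
qed

end

theorem theorem1p1:
  fixes f :: "nat \<Rightarrow> nat"
  assumes "strict_mono_on {1..} f"
    and "polynomially_bounded f"
  shows "\<exists>(L :: (nat \<Rightarrow> 'k::field) set) bracket.
           lie_algebra seq_scale L bracket \<and>
           lie_algebra.finitely_generated seq_scale L bracket \<and>
           (\<forall>X. finite X \<and> lie_algebra.generates seq_scale L bracket X \<longrightarrow>
              growth_equiv (lie_algebra.growth seq_scale bracket X) f)"
proof -
  obtain d where d: "growth_equiv (\<lambda>n. 1 + n + snd (greedy d f n)) f"
    using growth_equiv_greedy[OF assms] by blast
  interpret truncation d "\<lambda>n. fst (greedy d f n)"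
    by unfold_locales (rule mono_fst_greedy)
  let ?X = "generators :: (nat \<Rightarrow> 'k) set"
  have fin: "finite ?X" by (simp add: generators_def)
  have gen: "lie.generates ?X" by (rule generates_generators)
  \<comment> \<open>At \<open>n = 0\<close> the two sides are 0 and 1; only positive arguments
    count.\<close>
  have "lie.growth ?X n = 1 + n + snd (greedy d f n)" if "n \<ge> 1" for n
    using that by (simp add: growth_generators card_cells snd_greedy)
  then have "growth_equiv (lie.growth ?X) (\<lambda>n. 1 + n + snd (greedy d f n))"
    unfolding growth_equiv_def growth_le_def by (intro conjI exI[of _ 1]) simp_all
  from growth_equiv_trans[OF this d] have "growth_equiv (lie.growth ?X) f" .
  then have "growth_equiv (lie.growth X) f" if "finite X" "lie.generates X" for X :: "(nat \<Rightarrow> 'k) set"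
    using lie.growth_equiv_growth[OF that fin gen] by (rule growth_equiv_trans[rotated])
  moreover have "lie.finitely_generated TYPE('k)"
    using fin gen unfolding lie.finitely_generated_def by blast
  ultimately show ?thesis
    using lie_algebra_seq by blast
qed

end
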